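(* For each integer $n\ge 3$ let $G_n$ be the cubic graph, $C_0$ and $C_1$ the Hamiltonian cycles of $G_n$, and $g=\Lambda u_1$ the distinguished (green) edge, all defined in the context. Then, for every $n\ge 3$, Thomason's algorithm in $G_n$ started with the cycle $C_0$ and the edge $g$ (with initial vertex $\Lambda$) terminates with the cycle $C_1$. Moreover, the number of steps (lollipops) it takes is $\Theta(c^n)$ as $n\to\infty$, where $c>1$ is a constant with $c\approx 1.3953\ldots$ (the decimal expansion of $c$ begins $1.3953$).
   Context: **Lollipops and Thomason's algorithm.** Let $G$ be a cubic graph with $N$ vertices. Define an auxiliary graph $K(G)$ whose vertices are the oriented Hamiltonian paths of $G$. If $P=(p_1,\dots,p_N)$ is such a path and $p_i$, with $1<i<N-1$, is a neighbour of $p_N$ in $G$, then $P$ is adjacent in $K(G)$ to $Q=(p_1,\dots,p_i,p_N,p_{N-1},\dots,p_{i+1})$. This relation is symmetric. Every vertex of $K(G)$ has degree 1 or 2, and it has degree 1 exactly when $p_N$ is adjacent to $p_1$, i.e. when $P$ together with the edge $p_Np_1$ is a Hamiltonian cycle. Moving from a path to an adjacent one in $K(G)$ is called a lollipop (one step). Given a Hamiltonian cycle $C$, an edge $e=p_1p_2$ of $C$ and the initial vertex $p_1$, Thomason's algorithm starts from the oriented Hamiltonian path that begins $p_1,p_2$ and follows $C$. It repeatedly performs lollipops without ever moving back to the previous path, until it reaches another vertex of degree 1 of $K(G)$. It outputs the corresponding Hamiltonian cycle, which also contains $e$. **The graph $G_n$.** It consists of a triangle (the cap) on vertices $\Lambda,x,y$,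 then $n$ gadgets, the $i$-th having vertices $u_i,v_i$ ($1\le i\le n$), and a final triangle (the pac) on vertices $a,b,c'$. Use the notational convention $v_{-1}=\Lambda$, $v_0=y$, $u_0=x$, $v_{n+1}=a$, $u_{n+1}=c'$, $u_{n+2}=b$. The edges of $G_n$ are the three edges of each of the two triangles $\Lambda xy$ and $abc'$, together with - $u_iv_i$ for $1\le i\le n$ (the edge inside the $i$-th gadget), - $u_iv_{i+1}$ for $0\le i\le n$, - $v_iu_{i+2}$ for $-1\le i\le n$. Thus $|V(G_n)|=2n+6$ and $|E(G_n)|=3n+9$. The green edge is $g=\Lambda u_1$. **The cycles.** $C_0$ is the Hamiltonian cycle with edges $u_iv_i$ ($1\le i\le n$), $v_iu_{i+2}$ ($-1\le i\le n$), $\Lambda x$, $xy$, $ab$, $ac'$. $C_1$ is the Hamiltonian cycle with edges $u_iv_i$ for even $i$ with $1\le i\le n$; $u_iv_{i+1}$ for all $0\le i\le n$; $v_iu_{i+2}$ for all odd $i$ with $-1\le i\le n$; $\Lambda y$, $xy$; and, in the pac, $ab,bc'$ if $n$ is even and $ac',bc'$ if $n$ is odd. *)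

theory Defs
  imports Complex_Main "HOL-Library.Landau_Symbols"
begin

definition cubic_graph :: "'a set \<Rightarrow> 'a set set \<Rightarrow> bool" where
  "cubic_graph V E \<longleftrightarrow>
     finite V \<and>
     (\<forall>e\<in>E. \<exists>u v. u \<in> V \<and> v \<in> V \<and> u \<noteq> v \<and> e = {u, v}) \<and>
     (\<forall>v\<in>V. card {e \<in> E. v \<in> e} = 3)"

text \<open>An oriented Hamiltonian path is its vertex list; a Hamiltonian cycle is its edge set.\<close>

definition ham_path :: "'a set \<Rightarrow> 'a set set \<Rightarrow> 'a list \<Rightarrow> bool" where
  "ham_path V E p \<longleftrightarrow>
     distinct p \<and> set p = V \<and> (\<forall>i. Suc i < length p \<longrightarrow> {p ! i, p ! Suc i} \<in> E)"

definition cycle_edges :: "'a list \<Rightarrow> 'a set set" where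
  "cycle_edges p = {{p ! i, p ! Suc i} |i. Suc i < length p} \<union> {{last p, hd p}}"

definition ham_cycle :: "'a set \<Rightarrow> 'a set set \<Rightarrow> 'a set set \<Rightarrow> bool" where
  "ham_cycle V E C \<longleftrightarrow>
     (\<exists>p. ham_path V E p \<and> 3 \<le> length p \<and> {last p, hd p} \<in> E \<and> C = cycle_edges p)"

text \<open>
  Adjacency in the auxiliary graph \<open>K(G)\<close>. The index \<open>i\<close> is 1-based, so \<open>p\<^sub>i\<close> is
  \<open>P ! (i - 1)\<close>, and the new path is \<open>p\<^sub>1, \<dots>, p\<^sub>i, p\<^sub>N, p\<^sub>N\<^sub>-\<^sub>1, \<dots>, p\<^sub>i\<^sub>+\<^sub>1\<close>.
\<close>

definition lollipop :: "'a set \<Rightarrow> 'a set set \<Rightarrow> 'a list \<Rightarrow> 'a list \<Rightarrow> bool" where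
  "lollipop V E P Q \<longleftrightarrow>
     ham_path V E P \<and>
     (\<exists>i. 1 < i \<and> i < length P - 1 \<and> {P ! (i - 1), last P} \<in> E \<and>
          Q = take i P @ rev (drop i P))"

definition lollipop_degree :: "'a set \<Rightarrow> 'a set set \<Rightarrow> 'a list \<Rightarrow> nat" where
  "lollipop_degree V E P = card {Q. lollipop V E P Q}"

text \<open>
  \<open>Ps\<close> is the complete sequence of paths visited by Thomason's algorithm, from the initial
  path \<open>Ps ! 0\<close> to the first later path that has degree 1 in \<open>K(G)\<close>.
\<close>

definition thomason_run ::
  "'a set \<Rightarrow> 'a set set \<Rightarrow> 'a set set \<Rightarrow> 'a set \<Rightarrow> 'a \<Rightarrow> 'a list list \<Rightarrow> bool" where
  "thomason_run V E C e p\<^sub>1 Ps \<longleftrightarrow>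
     2 \<le> length Ps \<and>
     ham_path V E (Ps ! 0) \<and> hd (Ps ! 0) = p\<^sub>1 \<and> {Ps ! 0 ! 0, Ps ! 0 ! 1} = e \<and>
     cycle_edges (Ps ! 0) = C \<and>
     (\<forall>j. Suc j < length Ps \<longrightarrow> lollipop V E (Ps ! j) (Ps ! Suc j)) \<and>
     (\<forall>j. Suc (Suc j) < length Ps \<longrightarrow> Ps ! Suc (Suc j) \<noteq> Ps ! j) \<and>
     (\<forall>j. 0 < j \<and> Suc j < length Ps \<longrightarrow> lollipop_degree V E (Ps ! j) \<noteq> 1) \<and>
     lollipop_degree V E (last Ps) = 1"

text \<open>
  On a valid input (cubic graph, Hamiltonian cycle \<open>C\<close>, edge \<open>e\<close> of \<open>C\<close>, end \<open>p\<^sub>1\<close> of \<open>e\<close>),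
  Thomason's algorithm stops after exactly \<open>k\<close> lollipops and outputs the cycle \<open>D\<close>.
\<close>

definition thomason_halts ::
  "'a set \<Rightarrow> 'a set set \<Rightarrow> 'a set set \<Rightarrow> 'a set \<Rightarrow> 'a \<Rightarrow> nat \<Rightarrow> 'a set set \<Rightarrow> bool" where
  "thomason_halts V E C e p\<^sub>1 k D \<longleftrightarrow>
     cubic_graph V E \<and> ham_cycle V E C \<and> e \<in> C \<and> p\<^sub>1 \<in> e \<and>
     (\<exists>Ps. thomason_run V E C e p\<^sub>1 Ps \<and> k = length Ps - 1 \<and> D = cycle_edges (last Ps))"

text \<open>
  The vertices of \<open>G\<^sub>n\<close> are \<open>U i\<close> for \<open>0 \<le> i \<le> n + 2\<close> and \<open>V i\<close> for \<open>-1 \<le> i \<le> n + 1\<close>;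
  the cap and pac vertices are named through the index convention.
\<close>

datatype vertex = U int | V int

abbreviation cap_L :: vertex where "cap_L \<equiv> V (- 1)"
abbreviation cap_x :: vertex where "cap_x \<equiv> U 0"
abbreviation cap_y :: vertex where "cap_y \<equiv> V 0"
abbreviation pac_a :: "nat \<Rightarrow> vertex" where "pac_a n \<equiv> V (int n + 1)"
abbreviation pac_b :: "nat \<Rightarrow> vertex" where "pac_b n \<equiv> U (int n + 2)"
abbreviation pac_c :: "nat \<Rightarrow> vertex" where "pac_c n \<equiv> U (int n + 1)"

definition G_verts :: "nat \<Rightarrow> vertex set" where
  "G_verts n =
     {cap_L, cap_x, cap_y} \<union> {U i |i. 1 \<le> i \<and> i \<le> int n} \<union> {V i |i. 1 \<le> i \<and> i \<le> int n} \<union>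
     {pac_a n, pac_b n, pac_c n}"

definition G_edges :: "nat \<Rightarrow> vertex set set" where
  "G_edges n =
     {{cap_L, cap_x}, {cap_L, cap_y}, {cap_x, cap_y}} \<union>
     {{pac_a n, pac_b n}, {pac_a n, pac_c n}, {pac_b n, pac_c n}} \<union>
     {{U i, V i} |i. 1 \<le> i \<and> i \<le> int n} \<union>
     {{U i, V (i + 1)} |i. 0 \<le> i \<and> i \<le> int n} \<union>
     {{V i, U (i + 2)} |i. - 1 \<le> i \<and> i \<le> int n}"

definition green_edge :: "vertex set" where
  "green_edge = {cap_L, U 1}"

definition C0 :: "nat \<Rightarrow> vertex set set" where
  "C0 n =
     {{U i, V i} |i. 1 \<le> i \<and> i \<le> int n} \<union>
     {{V i, U (i + 2)} |i. - 1 \<le> i \<and> i \<le> int n} \<union>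
     {{cap_L, cap_x}, {cap_x, cap_y}, {pac_a n, pac_b n}, {pac_a n, pac_c n}}"

definition C1 :: "nat \<Rightarrow> vertex set set" where
  "C1 n =
     {{U i, V i} |i. even i \<and> 1 \<le> i \<and> i \<le> int n} \<union>
     {{U i, V (i + 1)} |i. 0 \<le> i \<and> i \<le> int n} \<union>
     {{V i, U (i + 2)} |i. odd i \<and> - 1 \<le> i \<and> i \<le> int n} \<union>
     {{cap_L, cap_y}, {cap_x, cap_y}} \<union>
     (if even n then {{pac_a n, pac_b n}, {pac_b n, pac_c n}}
      else {{pac_a n, pac_c n}, {pac_b n, pac_c n}})"

end

theory Submission
  imports Defs
begin

text \<open>
  Removing the first gadgets leaves a smaller graph of the same shape, joined to the rest by three
  edges. While the end of the Hamiltonian path moves inside it, the rest of the path matters only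
  through the pairing of these three edges. The five transformations of the right part that occur
  reduce to each other on the right part with one gadget less, and their lengths satisfy a linear
  system which gives \<open>s (n + 4) = 2 s (n + 1) + s n + 8\<close> for the number of lollipops. Hence \<open>c\<close> is
  the positive root of \<open>c\<^sup>4 = 2 c + 1\<close>. The whole run is one such transformation, namely that of
  everything to the right of the cap.
\<close>

text \<open>The five transformations involve only three Hamiltonian paths of the right part, one for
  each pair of joining edges: \<open>pathW\<close> is the same list as \<open>pathX\<close>, and
  \<open>pathY\<close> is the reverse of \<open>pathT\<close>. If the path enters the right part and
  leaves it again, the entry edge stays fixed, the exit moves to the third joining edge, and
  everything behind the exit is reversed. The three possible entries give the transformations X, T
  and S, which rotate the three paths. W and Y concern a path that ends inside the right part: W
  makes the same change as X, and Y undoes that of S, but with step counts of their own. Exhibiting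
  a run does not suffice, since the theorem is an equivalence in \<open>k\<close> and
  \<open>D\<close>. Degree bounds in K(G) make the run unique.\<close>

section \<open>Lollipops with their pivots\<close>

text \<open>
  The edges of the pivot \<open>z\<close> to both ends of \<open>B\<close> are required, so that the relation is symmetric.
\<close>

definition pivot_step :: "'a set set \<Rightarrow> 'a list \<Rightarrow> 'a \<Rightarrow> 'a list \<Rightarrow> bool" where
  "pivot_step E P z Q \<longleftrightarrow>
     (\<exists>A B. A \<noteq> [] \<and> 2 \<le> length B \<and> {z, hd B} \<in> E \<and> {z, last B} \<in> E \<and>
            P = A @ z # B \<and> Q = A @ z # rev B)"

lemma pivot_stepI:
  "A \<noteq> [] \<Longrightarrow> 2 \<le> length B \<Longrightarrow> {z, hd B} \<in> E \<Longrightarrow> {z, last B} \<in> E \<Longrightarrow> P = A @ z # B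
    \<Longrightarrow> Q = A @ z # rev B \<Longrightarrow> pivot_step E P z Q"
  unfolding pivot_step_def by blast

lemma pivot_step_sym: "pivot_step E P z Q \<Longrightarrow> pivot_step E Q z P"
  unfolding pivot_step_def by (metis hd_rev last_rev length_rev rev_rev_ident)

section \<open>Edge sets of vertex lists\<close>

definition path_edges :: "'a list \<Rightarrow> 'a set set" where
  "path_edges p = {{p ! i, p ! Suc i} |i. Suc i < length p}"

lemma path_edges_Nil [simp]: "path_edges [] = {}"
  and path_edges_single [simp]: "path_edges [x] = {}"
  by (simp_all add: path_edges_def)

lemma path_edges_Cons_Cons [simp]: "path_edges (x # y # p) = insert {x, y} (path_edges (y # p))"
proof (intro set_eqI iffI)
  fix e assume "e \<in> path_edges (x # y # p)"
  then obtain i where i: "Suc i < length (x # y # p)" "e = {(x # y # p) ! i, (x # y # p) ! Suc i}"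
    unfolding path_edges_def by blast
  then show "e \<in> insert {x, y} (path_edges (y # p))"
    by (cases i) (auto simp: path_edges_def)
next
  fix e assume "e \<in> insert {x, y} (path_edges (y # p))"
  then consider "e = {x, y}" | i where "Suc i < length (y # p)" "e = {(y # p) ! i, (y # p) ! Suc i}"
    unfolding path_edges_def by blast
  then show "e \<in> path_edges (x # y # p)"
  proof cases
    case 1
    then show ?thesis unfolding path_edges_def by (intro CollectI exI[of _ 0]) simp
  next
    case 2
    then show ?thesis unfolding path_edges_def by (intro CollectI exI[of _ "Suc i"]) simp
  qed
qed

lemma path_edges_Cons: "p \<noteq> [] \<Longrightarrow> path_edges (x # p) = insert {x, hd p} (path_edges p)"
  by (cases p) auto

lemma path_edges_append:
  "p \<noteq> [] \<Longrightarrow> q \<noteq> [] \<Longrightarrow>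
    path_edges (p @ q) = insert {last p, hd q} (path_edges p \<union> path_edges q)"
  by (induction p rule: induct_list012) (auto simp: path_edges_Cons)

lemma path_edges_rev [simp]: "path_edges (rev p) = path_edges p"
proof (induction p)
  case (Cons x p)
  then show ?case
    by (cases "p = []") (auto simp: path_edges_append path_edges_Cons last_rev insert_commute)
qed simp

lemma ham_path_iff: "ham_path W E p \<longleftrightarrow> distinct p \<and> set p = W \<and> path_edges p \<subseteq> E"
  unfolding ham_path_def path_edges_def by blast

lemma cycle_edges_eq: "cycle_edges p = insert {last p, hd p} (path_edges p)"
  unfolding cycle_edges_def path_edges_def by blast

lemma ham_path_pivot_step:
  assumes "ham_path W E P" "pivot_step E P z Q"
  shows "ham_path W E Q"
proof -
  obtain A B where *: "A \<noteq> []" "2 \<le> length B" "{z, last B} \<in> E" "P = A @ z # B" "Q = A @ z # rev B"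
    using assms(2) unfolding pivot_step_def by blast
  then have "B \<noteq> []" by auto
  with * assms(1) show ?thesis
    by (auto simp: ham_path_iff path_edges_append path_edges_Cons hd_rev)
qed

text \<open>The edge \<open>{z, hd B}\<close> demanded by \<open>pivot_step\<close> already lies on
  the Hamiltonian path, so only \<open>{z, last B}\<close> is a condition. The index in
  \<open>lollipop\<close> is \<open>Suc (length A)\<close>.\<close>

lemma lollipop_iff:
  "lollipop W E P Q \<longleftrightarrow> ham_path W E P \<and> (\<exists>z. pivot_step E P z Q)"
proof (intro iffI conjI)
  assume "lollipop W E P Q"
  then obtain i where ham: "ham_path W E P" and i: "1 < i" "i < length P - 1"
      "{P ! (i - 1), last P} \<in> E" "Q = take i P @ rev (drop i P)"
    unfolding lollipop_def by blast
  show "ham_path W E P" by (fact ham)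
  define A z B where "A = take (i - 1) P" and "z = P ! (i - 1)" and "B = drop i P"
  have z: "take i P = A @ [z]"
    using i take_Suc_conv_app_nth[of "i - 1" P] by (simp add: A_def z_def)
  then have P: "P = A @ z # B"
    by (metis B_def append_Cons append_Nil append_assoc append_take_drop_id)
  have "2 \<le> length B" using i by (simp add: B_def)
  then have "B \<noteq> []" by auto
  have "{z, last B} \<in> E" "A \<noteq> []"
    using i \<open>B \<noteq> []\<close> by (auto simp: z_def A_def B_def)
  moreover from this have "{z, hd B} \<in> E"
    using ham \<open>B \<noteq> []\<close> by (auto simp: ham_path_iff P path_edges_append path_edges_Cons)
  moreover have "Q = A @ z # rev B"
    using i(4) by (simp add: z flip: B_def)
  ultimately show "\<exists>z. pivot_step E P z Q"
    using P \<open>2 \<le> length B\<close> by (blast intro: pivot_stepI)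
next
  assume "ham_path W E P \<and> (\<exists>z. pivot_step E P z Q)"
  then obtain z A B where ham: "ham_path W E P" and *: "A \<noteq> []" "2 \<le> length B"
      "{z, last B} \<in> E" "P = A @ z # B" "Q = A @ z # rev B"
    unfolding pivot_step_def by blast
  from *(2) have "B \<noteq> []" by auto
  with ham * show "lollipop W E P Q"
    unfolding lollipop_def by (intro conjI exI[of _ "Suc (length A)"]) (auto simp: nth_append)
qed

lemma lollipop_sym: "lollipop W E P Q \<Longrightarrow> lollipop W E Q P"
  using ham_path_pivot_step pivot_step_sym unfolding lollipop_iff by metis

text \<open>The two paths agree up to the pivot and differ right after it, because
  \<open>hd B \<noteq> last B\<close>. So the pivot is the end of their longest common
  prefix.\<close>

lemma pivot_step_pivot_unique:
  assumes "distinct P" "pivot_step E P z Q" "pivot_step E Q z' P"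
  shows "z' = z"
proof -
  obtain A B where 1: "2 \<le> length B" "P = A @ z # B" "Q = A @ z # rev B"
    using assms(2) unfolding pivot_step_def by blast
  obtain A' B' where 2: "2 \<le> length B'" "Q = A' @ z' # B'" "P = A' @ z' # rev B'"
    using assms(3) unfolding pivot_step_def by blast
  have dist: "hd C \<noteq> last C" if "2 \<le> length C" "distinct C" for C :: "'a list"
    using that by (cases C) (auto split: if_splits)
  have dB: "hd B \<noteq> last B" "hd B' \<noteq> last B'" "B \<noteq> []" "B' \<noteq> []"
  proof -
    have "distinct B" using assms(1) unfolding 1 by simp
    then show "hd B \<noteq> last B" using 1(1) by (rule dist[rotated])
    have "distinct B'" using assms(1) unfolding 2 by simp
    then show "hd B' \<noteq> last B'" using 2(1) by (rule dist[rotated])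
  qed (use 1 2 in auto)
  have nth: "(C @ x # D) ! Suc (length C) = hd D" if "D \<noteq> []" for C D :: "'a list" and x
    using that by (simp add: nth_append hd_conv_nth)
  have "P ! Suc (length A) = hd B" "Q ! Suc (length A) = last B"
    unfolding 1 using dB by (simp_all add: nth hd_rev)
  moreover have "P ! Suc (length A') = last B'" "Q ! Suc (length A') = hd B'"
    unfolding 2 using dB by (simp_all add: nth hd_rev)
  moreover have "P ! i = Q ! i" if "i \<le> length A" for i
    using that unfolding 1 by (auto simp: nth_append)
  moreover have "P ! i = Q ! i" if "i \<le> length A'" for i
    using that unfolding 2 by (auto simp: nth_append)
  ultimately have "\<not> Suc (length A) \<le> length A'" "\<not> Suc (length A') \<le> length A"
    using dB by metis+
  then have "length A = length A'" by simp
  then show ?thesis using 1(2) 2(3) by (metis append_eq_append_conv list.inject)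
qed

lemma pivot_step_functional:
  assumes "distinct P" "pivot_step E P z Q" "pivot_step E P z Q'"
  shows "Q = Q'"
proof -
  obtain A B where 1: "P = A @ z # B" "Q = A @ z # rev B"
    using assms(2) unfolding pivot_step_def by blast
  obtain A' B' where 2: "P = A' @ z # B'" "Q' = A' @ z # rev B'"
    using assms(3) unfolding pivot_step_def by blast
  have "z \<notin> set A" "z \<notin> set B"
    using assms(1) by (auto simp: 1)
  then have "A' = A \<and> B' = B"
    using 1(1) 2(1) by (metis append_Cons_eq_iff)
  then show ?thesis using 1 2 by simp
qed

section \<open>Degrees in K(G)\<close>

lemma finite_lollipops: "finite {Q. lollipop W E P Q}"
proof (rule finite_surj)
  show "{Q. lollipop W E P Q} \<subseteq> (\<lambda>i. take i P @ rev (drop i P)) ` {..<length P}"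
    unfolding lollipop_def by auto
qed simp


text \<open>
  The edge at the last vertex that is already on the path cannot be used, and the edge to the
  first vertex is excluded by definition.
\<close>

lemma lollipop_degree_le:
  assumes "cubic_graph W E" "ham_path W E P" "2 < length P"
  shows "lollipop_degree W E P \<le> 2"
    and "{hd P, last P} \<in> E \<Longrightarrow> lollipop_degree W E P \<le> 1"
proof -
  define I where "I = {e \<in> E. last P \<in> e}"
  have "P \<noteq> []" using assms(3) by auto
  then have "last P \<in> W" using assms(2) by (auto simp: ham_path_iff)
  then have "card I = 3" using assms(1) by (simp add: cubic_graph_def I_def)
  then have "finite I" by (metis card.infinite zero_neq_numeral)
  obtain p A r b where P: "P = r # A @ [p, b]"
  proof -
    obtain r P' where "P = r # P'" using \<open>P \<noteq> []\<close> by (cases P) auto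
    moreover obtain P'' b where "P' = P'' @ [b]"
      using assms(3) calculation by (cases P' rule: rev_cases) auto
    moreover obtain A p where "P'' = A @ [p]"
      using assms(3) calculation by (cases P'' rule: rev_cases) auto
    ultimately show ?thesis using that by simp
  qed
  have dist: "distinct P" using assms(2) by (simp add: ham_path_iff)
  have pb: "{p, b} \<in> I"
    using assms(2) path_edges_append[of "r # A" "[p, b]"] by (simp add: P I_def ham_path_iff)
  \<comment> \<open>Each pivot determines its successor, and distinct pivots give distinct edges at
    the last vertex \<open>b\<close>; so counting edges at \<open>b\<close> bounds the
    degree.\<close>
  define Z where "Z = {z. \<exists>Q. pivot_step E P z Q}"
  have Z: "{z, b} \<in> I - {{p, b}, {r, b}}" if "z \<in> Z" for z
  proof -
    from that obtain C B where *: "C \<noteq> []" "2 \<le> length B" "{z, last B} \<in> E" "P = C @ z # B"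
      unfolding Z_def pivot_step_def by blast
    then obtain B' x y where B: "B = B' @ [x, y]"
    proof -
      obtain B'' y where "B = B'' @ [y]" using *(2) by (cases B rule: rev_cases) auto
      moreover obtain B' x where "B'' = B' @ [x]"
        using *(2) calculation by (cases B'' rule: rev_cases) auto
      ultimately show ?thesis using that by simp
    qed
    have "y = b" "x = p" "C @ z # B' = r # A" using *(4) by (simp_all add: P B)
    then have "z \<noteq> p" "z \<noteq> r" "z \<noteq> b" "{z, b} \<in> E"
      using dist * by (auto simp: P B Cons_eq_append_conv)
    then show ?thesis by (auto simp: I_def P doubleton_eq_iff)
  qed
  have inj: "inj_on (\<lambda>z. {z, b}) Z"
    by (auto simp: inj_on_def doubleton_eq_iff)
  define next_path where "next_path = (\<lambda>z. THE Q. pivot_step E P z Q)"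
  have nxt: "Q = next_path z" if "pivot_step E P z Q" for z Q
    unfolding next_path_def using pivot_step_functional[OF dist] that by (metis the_equality)
  have fin: "finite Z" and le: "card Z \<le> card (I - {{p, b}, {r, b}})"
    using \<open>finite I\<close> inj Z
    by (auto intro: finite_imageD[of "\<lambda>z. {z, b}"] finite_subset[of _ I] card_inj_on_le)
  have "{Q. lollipop W E P Q} \<subseteq> next_path ` Z"
    unfolding lollipop_iff Z_def using nxt by blast
  then have deg: "lollipop_degree W E P \<le> card Z"
    unfolding lollipop_degree_def using fin by (meson card_image_le card_mono finite_imageI le_trans)
  have "card (I - {{p, b}, {r, b}}) \<le> card (I - {{p, b}})"
    using \<open>finite I\<close> by (intro card_mono) auto
  also have "\<dots> = 2" using pb \<open>finite I\<close> \<open>card I = 3\<close> by simp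
  finally show "lollipop_degree W E P \<le> 2" using deg le by simp
  assume "{hd P, last P} \<in> E"
  then have "{{p, b}, {r, b}} \<subseteq> I" "{p, b} \<noteq> {r, b}"
    using pb dist by (auto simp: P I_def doubleton_eq_iff)
  then have "card (I - {{p, b}, {r, b}}) = 1"
    using \<open>card I = 3\<close> by (subst card_Diff_subset) auto
  then show "lollipop_degree W E P \<le> 1" using deg le by simp
qed


section \<open>Runs of Thomason's algorithm\<close>

text \<open>
  \<open>pivot_run E P z k Q f\<close>: \<open>k\<close> lollipops lead from \<open>P\<close> to \<open>Q\<close>, the first pivot is \<open>z\<close> and the
  last one is \<open>f\<close>. A lollipop undoes the preceding one iff both have the same pivot, so runs are
  composed by comparing pivots only.
\<close>

inductive pivot_run :: "'a set set \<Rightarrow> 'a list \<Rightarrow> 'a \<Rightarrow> nat \<Rightarrow> 'a list \<Rightarrow> 'a \<Rightarrow> bool" for E where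
  single: "pivot_step E P z Q \<Longrightarrow> pivot_run E P z 1 Q z"
| step: "pivot_step E P z Q \<Longrightarrow> z \<noteq> z' \<Longrightarrow> pivot_run E Q z' k R f \<Longrightarrow> pivot_run E P z (Suc k) R f"

lemma pivot_run_trans:
  assumes "pivot_run E P z k Q f" "f \<noteq> z'" "pivot_run E Q z' l R g"
  shows "pivot_run E P z (k + l) R g"
  using assms by induction (auto intro: pivot_run.intros)

lemma pivot_run_sym:
  assumes "pivot_run E P z k Q f"
  shows "pivot_run E Q f k P z"
  using assms
proof induction
  case (single P z Q)
  then show ?case by (blast intro: pivot_run.single pivot_step_sym)
next
  case (step P z Q z' k R f)
  then have "pivot_run E Q z 1 P z"
    by (blast intro: pivot_run.single pivot_step_sym)
  then show ?case
    using pivot_run_trans[OF step.IH] step.hyps(2) by fastforce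
qed

text \<open>The conjunct on \<open>Ps ! 1\<close> strengthens the induction: it exposes the first
  pivot, and a path prepended with another pivot cannot then equal \<open>Ps ! 1\<close>.\<close>

lemma pivot_run_paths:
  assumes "pivot_run E P z k Q f" "ham_path W E P"
  shows "\<exists>Ps. length Ps = Suc k \<and> Ps ! 0 = P \<and> last Ps = Q \<and> pivot_step E P z (Ps ! 1) \<and>
    (\<forall>j. Suc j < length Ps \<longrightarrow> lollipop W E (Ps ! j) (Ps ! Suc j)) \<and>
    (\<forall>j. Suc (Suc j) < length Ps \<longrightarrow> Ps ! Suc (Suc j) \<noteq> Ps ! j)"
  using assms
proof induction
  case (single P z Q)
  then show ?case
    by (intro exI[of _ "[P, Q]"]) (auto simp: lollipop_iff less_Suc_eq)
next
  case (step P z Q z' k R f)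
  have "ham_path W E Q"
    using step.prems step.hyps(1) by (rule ham_path_pivot_step)
  then obtain Ps where Ps: "length Ps = Suc k" "Ps ! 0 = Q" "last Ps = R"
      "pivot_step E Q z' (Ps ! 1)"
      "\<forall>j. Suc j < length Ps \<longrightarrow> lollipop W E (Ps ! j) (Ps ! Suc j)"
      "\<forall>j. Suc (Suc j) < length Ps \<longrightarrow> Ps ! Suc (Suc j) \<noteq> Ps ! j"
    using step.IH by blast
  have "distinct P"
    using step.prems by (simp add: ham_path_iff)
  then have ne: "Ps ! 1 \<noteq> P"
    using Ps(4) step.hyps(1,2) pivot_step_pivot_unique by metis
  have lol: "lollipop W E P Q"
    using step by (auto simp: lollipop_iff)
  show ?case
  proof (intro exI[of _ "P # Ps"] conjI allI impI)
    fix j assume "Suc j < length (P # Ps)"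
    then show "lollipop W E ((P # Ps) ! j) ((P # Ps) ! Suc j)"
      using Ps lol by (cases j) auto
  next
    fix j assume "Suc (Suc j) < length (P # Ps)"
    then show "(P # Ps) ! Suc (Suc j) \<noteq> (P # Ps) ! j"
      using Ps ne by (cases j) auto
  qed (use Ps step.hyps(1) in auto)
qed

section \<open>Determinism of the algorithm\<close>

lemma cycle_edges_neighbour:
  assumes "distinct p" "Suc (Suc i) < length p" "{p ! Suc i, x} \<in> cycle_edges p"
  shows "x = p ! i \<or> x = p ! Suc (Suc i)"
proof -
  from assms(3) consider j where "Suc j < length p" "{p ! Suc i, x} = {p ! j, p ! Suc j}"
    | "{p ! Suc i, x} = {last p, hd p}"
    unfolding cycle_edges_def by blast
  then show ?thesis
  proof cases
    case 1
    then show ?thesis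
      using assms(1,2) by (auto simp: doubleton_eq_iff nth_eq_iff_index_eq)
  next
    case 2
    moreover have "p \<noteq> []" using assms(2) by auto
    then have "last p = p ! (length p - 1)" "hd p = p ! 0"
      by (rule last_conv_nth, rule hd_conv_nth)
    ultimately have "p ! Suc i = p ! (length p - 1) \<and> x = p ! 0 \<or> p ! Suc i = p ! 0"
      by (auto simp: doubleton_eq_iff)
    moreover have "length p - 1 < length p" "0 < length p" "Suc i < length p"
      using assms(2) by linarith+
    ultimately have "Suc i = length p - 1 \<or> Suc i = 0"
      using nth_eq_iff_index_eq[OF assms(1)] by metis
    then show ?thesis
      using assms(2) by auto
  qed
qed

text \<open>From the third vertex on, each vertex is the cycle neighbour of its predecessor other
  than the one before that. This pins down the initial path, which \<open>thomason_run\<close> gives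
  only through its cycle and first edge.\<close>

lemma ham_path_eqI:
  assumes "ham_path W E p" "ham_path W E q" "cycle_edges p = cycle_edges q"
    and "p ! 0 = q ! 0" "p ! 1 = q ! 1"
  shows "p = q"
proof -
  have dist: "distinct p" "distinct q"
    using assms(1,2) by (auto simp: ham_path_iff)
  have len: "length p = length q"
    using assms(1,2) unfolding ham_path_iff by (metis distinct_card)
  have "i < length p \<longrightarrow> p ! i = q ! i" for i
  proof (induction i rule: less_induct)
    case (less i)
    consider "i = 0" | "i = 1" | j where "i = Suc (Suc j)"
      by (metis One_nat_def not0_implies_Suc)
    then show ?case
    proof cases
      case 3
      show ?thesis
      proof
        assume i: "i < length p"
        then have IH: "p ! j = q ! j" "p ! Suc j = q ! Suc j"
          using less 3 by simp_all
        have "{q ! Suc j, q ! i} \<in> cycle_edges q"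
          unfolding cycle_edges_def using i len 3 by auto
        then have "{p ! Suc j, q ! i} \<in> cycle_edges p"
          by (simp only: IH assms(3))
        then have "q ! i = p ! j \<or> q ! i = p ! i"
          using cycle_edges_neighbour[OF dist(1)] i 3 by blast
        moreover have "q ! i \<noteq> q ! j"
          using dist(2) i len 3 by (simp add: nth_eq_iff_index_eq)
        ultimately show "p ! i = q ! i" by (metis IH(1))
      qed
    qed (use assms(4,5) in simp_all)
  qed
  then show ?thesis using len by (simp add: nth_equalityI)
qed

lemma card_le_oneD: "finite A \<Longrightarrow> card A \<le> 1 \<Longrightarrow> x \<in> A \<Longrightarrow> y \<in> A \<Longrightarrow> x = y"
  by (metis card_le_Suc0_iff_eq One_nat_def)

lemma card_le_twoD:
  assumes "finite A" "card A \<le> 2" "x \<in> A" "y \<in> A" "z \<in> A" "y \<noteq> x" "z \<noteq> x"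
  shows "y = z"
  using assms card_le_oneD[of "A - {x}" y z] by simp

text \<open>The initial path closes up along an edge of \<open>C\<close>, hence has at most one
  successor; every later path has at most two neighbours, one of them being the forbidden
  predecessor.\<close>

lemma thomason_run_unique:
  assumes cubic: "cubic_graph W E" and big: "2 < card W" and sub: "C \<subseteq> E"
    and Ps: "thomason_run W E C e p Ps" and Qs: "thomason_run W E C e p Qs"
  shows "Ps = Qs"
proof -
  have len: "length P = card W" if "ham_path W E P" for P
    using that by (auto simp: ham_path_iff distinct_card)
  have ham0: "ham_path W E (Rs ! 0)" "{hd (Rs ! 0), last (Rs ! 0)} \<in> E"
      "hd (Rs ! 0) = p" "{Rs ! 0 ! 0, Rs ! 0 ! 1} = e" "cycle_edges (Rs ! 0) = C"
    if "thomason_run W E C e p Rs" for Rs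
    using that sub unfolding thomason_run_def cycle_edges_def by (auto simp: insert_commute)
  have "Rs ! 0 ! 0 = p" if "thomason_run W E C e p Rs" for Rs
    using ham0[OF that] len[of "Rs ! 0"] big by (cases "Rs ! 0") auto
  then have start: "Ps ! 0 = Qs ! 0"
    using ham0[OF Ps] ham0[OF Qs] Ps Qs
    by (intro ham_path_eqI[of W E]) (auto simp: doubleton_eq_iff)
  have deg: "card {Q. lollipop W E P Q} \<le> 2"
    and deg1: "{hd P, last P} \<in> E \<Longrightarrow> card {Q. lollipop W E P Q} \<le> 1" if "ham_path W E P" for P
    using lollipop_degree_le[OF cubic that] len[OF that] big by (auto simp: lollipop_degree_def)
  have agree: "j < length Ps \<longrightarrow> j < length Qs \<longrightarrow> Ps ! j = Qs ! j" for j
  proof (induction j rule: less_induct)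
    case (less j)
    consider "j = 0" | "j = 1" | i where "j = Suc (Suc i)"
      by (metis One_nat_def not0_implies_Suc)
    then show ?case
    proof cases
      case 2
      show ?thesis
      proof (intro impI)
        assume "j < length Ps" "j < length Qs"
        then have "lollipop W E (Ps ! 0) (Ps ! 1)" "lollipop W E (Qs ! 0) (Qs ! 1)"
          using Ps Qs 2 unfolding thomason_run_def by auto
        then show "Ps ! j = Qs ! j"
          using card_le_oneD[OF finite_lollipops deg1] ham0[OF Ps] start 2 by auto
      qed
    next
      case 3
      show ?thesis
      proof (intro impI)
        assume *: "j < length Ps" "j < length Qs"
        then have eq: "Ps ! i = Qs ! i" "Ps ! Suc i = Qs ! Suc i"
          using less 3 by auto
        have "lollipop W E (Ps ! Suc i) (Ps ! j)" "lollipop W E (Ps ! i) (Ps ! Suc i)"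
            "lollipop W E (Qs ! Suc i) (Qs ! j)" "Ps ! j \<noteq> Ps ! i" "Qs ! j \<noteq> Qs ! i"
          using Ps Qs * 3 unfolding thomason_run_def by auto
        moreover from this have "lollipop W E (Ps ! Suc i) (Ps ! i)"
          using lollipop_sym by blast
        moreover from this have "ham_path W E (Ps ! Suc i)"
          by (simp add: lollipop_iff)
        ultimately show "Ps ! j = Qs ! j"
          using card_le_twoD[OF finite_lollipops deg, of "Ps ! Suc i" "Ps ! i" "Ps ! j" "Qs ! j"] eq
          by auto
      qed
    qed (use start in simp)
  qed
  \<comment> \<open>No run is a proper prefix of another: its last path has degree 1, and the inner
    paths of a run do not.\<close>
  have len_le: "\<not> length Rs < length Ss"
    if "thomason_run W E C e p Rs" "thomason_run W E C e p Ss"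
      "\<And>j. j < length Rs \<Longrightarrow> j < length Ss \<Longrightarrow> Rs ! j = Ss ! j" for Rs Ss
  proof
    assume less: "length Rs < length Ss"
    have "2 \<le> length Rs" "lollipop_degree W E (last Rs) = 1"
      using that(1) by (auto simp: thomason_run_def)
    moreover from this have "last Rs = Ss ! (length Rs - 1)"
      using that(3)[of "length Rs - 1"] less by (subst last_conv_nth) auto
    moreover have "0 < length Rs - 1" "Suc (length Rs - 1) < length Ss"
      using less \<open>2 \<le> length Rs\<close> by auto
    ultimately show False
      using that(2) unfolding thomason_run_def by metis
  qed
  have "length Ps = length Qs"
    using len_le[OF Ps Qs] len_le[OF Qs Ps] agree by fastforce
  then show ?thesis using agree by (simp add: nth_equalityI)
qed

theorem thomason_halts_iff_pivot_run:
  assumes cubic: "cubic_graph W E" and ham: "ham_path W E P" and big: "2 < card W"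
    and cyc: "{hd P, last P} \<in> E" and run: "pivot_run E P z k Q f" and cyc': "{hd Q, last Q} \<in> E"
  shows "thomason_halts W E (cycle_edges P) {P ! 0, P ! 1} (hd P) l D \<longleftrightarrow>
    l = k \<and> D = cycle_edges Q"
proof -
  have len: "length P = card W" if "ham_path W E P" for P
    using that by (auto simp: ham_path_iff distinct_card)
  have sub: "cycle_edges P \<subseteq> E"
    using ham cyc by (auto simp: cycle_edges_eq ham_path_iff insert_commute)
  obtain Ps where Ps: "length Ps = Suc k" "Ps ! 0 = P" "last Ps = Q"
      and lol: "\<And>j. Suc j < length Ps \<Longrightarrow> lollipop W E (Ps ! j) (Ps ! Suc j)"
      and nb: "\<And>j. Suc (Suc j) < length Ps \<Longrightarrow> Ps ! Suc (Suc j) \<noteq> Ps ! j"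
    using pivot_run_paths[OF run ham] by blast
  have "0 < k"
    using run by cases auto
  have "Ps ! k = Q"
    using Ps last_conv_nth[of Ps] by fastforce
  then have "lollipop W E (Ps ! (k - 1)) Q"
    using lol[of "k - 1"] Ps \<open>0 < k\<close> by simp
  then have Q: "lollipop W E Q (Ps ! (k - 1))"
    by (rule lollipop_sym)
  then have "ham_path W E Q"
    by (simp add: lollipop_iff)
  then have "lollipop_degree W E Q \<le> 1"
    using cubic cyc' len big by (intro lollipop_degree_le) auto
  moreover have "lollipop_degree W E Q \<noteq> 0"
    using Q finite_lollipops[of W E Q] unfolding lollipop_degree_def by (auto simp: card_eq_0_iff)
  ultimately have degQ: "lollipop_degree W E Q = 1" by simp
  \<comment> \<open>With degree 1 the predecessor and the successor would coincide, which is a move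
    back.\<close>
  have mid: "lollipop_degree W E (Ps ! j) \<noteq> 1" if j: "0 < j \<and> Suc j < length Ps" for j
  proof
    assume "lollipop_degree W E (Ps ! j) = 1"
    moreover obtain i where i: "j = Suc i" using j by (cases j) auto
    moreover have "lollipop W E (Ps ! i) (Ps ! j)" "lollipop W E (Ps ! j) (Ps ! Suc j)"
      using lol[of i] lol[of j] j i by simp_all
    moreover from this(1) have "lollipop W E (Ps ! j) (Ps ! i)"
      by (rule lollipop_sym)
    ultimately have "Ps ! i = Ps ! Suc j"
      using card_le_oneD[OF finite_lollipops[of W E "Ps ! j"], of "Ps ! i" "Ps ! Suc j"]
      by (simp add: lollipop_degree_def)
    then show False using nb[of i] j i by simp
  qed
  have Ps_run: "thomason_run W E (cycle_edges P) {P ! 0, P ! 1} (hd P) Ps"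
    unfolding thomason_run_def
  proof (intro conjI allI impI)
    show "2 \<le> length Ps" using Ps(1) \<open>0 < k\<close> by simp
  qed (use ham Ps lol nb mid degQ in simp_all)
  have "P \<noteq> []" using len[OF ham] big by auto
  have "ham_cycle W E (cycle_edges P)"
    unfolding ham_cycle_def using ham cyc len[OF ham] big
    by (intro exI[of _ P]) (auto simp: insert_commute)
  moreover have "{P ! 0, P ! 1} \<in> cycle_edges P"
    unfolding cycle_edges_def using len[OF ham] big by auto
  moreover have "hd P \<in> {P ! 0, P ! 1}"
    using \<open>P \<noteq> []\<close> by (simp add: hd_conv_nth)
  moreover have "Qs = Ps" if "thomason_run W E (cycle_edges P) {P ! 0, P ! 1} (hd P) Qs" for Qs
    using thomason_run_unique[OF cubic big sub that Ps_run] .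
  ultimately have "thomason_halts W E (cycle_edges P) {P ! 0, P ! 1} (hd P) l D \<longleftrightarrow>
      l = length Ps - 1 \<and> D = cycle_edges (last Ps)"
    unfolding thomason_halts_def using cubic Ps_run by metis
  then show ?thesis
    using Ps by simp
qed

section \<open>Excursions into the right part of the graph\<close>

text \<open>The index convention makes the triangle edges xy and ac' the cases \<open>i = 0\<close>
  and \<open>i = n + 1\<close> of the gadget pattern; only \<Lambda>x and ab remain as exceptions.
  Adjacency thereby becomes linear arithmetic.\<close>

lemma UV_edge_iff:
  "{U i, V j} \<in> G_edges n \<longleftrightarrow>
    j = i \<and> 0 \<le> i \<and> i \<le> int n + 1 \<or> j = i + 1 \<and> 0 \<le> i \<and> i \<le> int n \<or>
    i = j + 2 \<and> - 1 \<le> j \<and> j \<le> int n \<or> i = 0 \<and> j = - 1 \<or> i = int n + 2 \<and> j = int n + 1"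
  (is "_ \<longleftrightarrow> ?R")
proof
  assume "{U i, V j} \<in> G_edges n"
  then show ?R
    unfolding G_edges_def Un_iff insert_iff empty_iff mem_Collect_eq doubleton_eq_iff vertex.simps
    by (elim disjE exE conjE; simp)
next
  assume ?R
  then consider "j = i" "i = 0" | "j = i" "1 \<le> i" "i \<le> int n" | "j = i" "i = int n + 1"
    | "j = i + 1" "0 \<le> i" "i \<le> int n" | "i = j + 2" "- 1 \<le> j" "j \<le> int n"
    | "i = 0" "j = - 1" | "i = int n + 2" "j = int n + 1"
    by linarith
  then show "{U i, V j} \<in> G_edges n"
  proof cases
    case 2
    then have "{U i, V j} \<in> {{U i, V i} |i. 1 \<le> i \<and> i \<le> int n}" by blast
    then show ?thesis by (simp only: G_edges_def Un_iff simp_thms)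
  next
    case 4
    then have "{U i, V j} \<in> {{U i, V (i + 1)} |i. 0 \<le> i \<and> i \<le> int n}" by blast
    then show ?thesis by (simp only: G_edges_def Un_iff simp_thms)
  next
    case 5
    then have "{V j, U i} \<in> {{V i, U (i + 2)} |i. - 1 \<le> i \<and> i \<le> int n}" by blast
    then show ?thesis by (simp only: G_edges_def Un_iff simp_thms insert_commute[of "U i"])
  qed (simp_all add: G_edges_def doubleton_eq_iff)
qed

lemma VU_edge_iff: "{V j, U i} \<in> G_edges n \<longleftrightarrow> {U i, V j} \<in> G_edges n"
  by (simp add: insert_commute)

lemma UU_edge_iff:
  "{U i, U j} \<in> G_edges n \<longleftrightarrow>
    i = int n + 1 \<and> j = int n + 2 \<or> i = int n + 2 \<and> j = int n + 1"
  unfolding G_edges_def by (auto simp: doubleton_eq_iff)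

lemma VV_edge_iff: "{V i, V j} \<in> G_edges n \<longleftrightarrow> i = - 1 \<and> j = 0 \<or> i = 0 \<and> j = - 1"
  unfolding G_edges_def by (auto simp: doubleton_eq_iff)

lemmas edge_iff = UV_edge_iff VU_edge_iff UU_edge_iff VV_edge_iff

text \<open>
  Let \<open>R\<^sub>k\<close> be induced by the \<open>m = n + 1 - k\<close> gadgets from \<open>k\<close> on together with the pac. Three
  edges join it to the rest of the graph: \<open>\<alpha>\<close> at \<open>V k\<close>, \<open>\<beta>\<close> at \<open>U k\<close> and \<open>\<gamma>\<close> at \<open>U (k + 1)\<close>. The
  following Hamiltonian paths of \<open>R\<^sub>k\<close> lead from \<open>\<beta>\<close> to \<open>\<gamma>\<close> (\<open>pathS\<close>), from \<open>\<beta>\<close> to \<open>\<alpha>\<close> (\<open>pathX\<close>,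
  \<open>pathW\<close>), from \<open>\<alpha>\<close> to \<open>\<gamma>\<close> (\<open>pathT\<close>) and from \<open>\<gamma>\<close> to \<open>\<alpha>\<close> (\<open>pathY\<close>).
\<close>

fun pathS :: "int \<Rightarrow> nat \<Rightarrow> vertex list" where
  "pathS k 0 = [U k, V k, U (k + 1)]"
| "pathS k (Suc m) = U k # V k # rev (pathS (k + 1) m)"

fun pathX pathT pathW pathY :: "int \<Rightarrow> nat \<Rightarrow> vertex list" where
  "pathX k 0 = [U k, U (k + 1), V k]"
| "pathT k 0 = [V k, U k, U (k + 1)]"
| "pathW k 0 = [U k, U (k + 1), V k]"
| "pathY k 0 = [U (k + 1), U k, V k]"
| "pathX k (Suc m) = U k # pathT (k + 1) m @ [V k]"
| "pathT k (Suc m) = V k # U k # rev (pathW (k + 1) m)"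
| "pathW k (Suc m) = U k # rev (pathY (k + 1) m) @ [V k]"
| "pathY k (Suc m) = pathX (k + 1) m @ [U k, V k]"

lemma pathS_nonempty [simp]: "pathS k m \<noteq> []"
  by (cases m) auto

lemma path_nonempty [simp]:
  "pathX k m \<noteq> []" "pathT k m \<noteq> []" "pathW k m \<noteq> []" "pathY k m \<noteq> []"
  by (cases m; simp)+

lemma hd_pathS [simp]: "hd (pathS k m) = U k"
  by (cases m) simp_all

lemma last_pathS [simp]: "last (pathS k m) = U (k + 1)"
  by (cases m) (simp_all add: last_rev)

lemma hd_last_pathX [simp]: "hd (pathX k m) = U k" "last (pathX k m) = V k"
  by (cases m; simp)+

lemma hd_last_pathW [simp]: "hd (pathW k m) = U k" "last (pathW k m) = V k"
  by (cases m; simp)+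

lemma hd_last_pathT [simp]: "hd (pathT k m) = V k" "last (pathT k m) = U (k + 1)"
  by (cases m; simp add: last_rev)+

lemma hd_last_pathY [simp]: "hd (pathY k m) = U (k + 1)" "last (pathY k m) = V k"
  by (cases m; simp)+

lemma length_pathS [simp]: "length (pathS k m) = 2 * m + 3"
  by (induction m arbitrary: k) simp_all

lemma length_path [simp]:
  "length (pathX k m) = 2 * m + 3" "length (pathT k m) = 2 * m + 3"
  "length (pathW k m) = 2 * m + 3" "length (pathY k m) = 2 * m + 3"
  by (induction m arbitrary: k) simp_all

text \<open>The bracketing copies the nesting of \<open>pivot_run_trans\<close> in
  \<open>right_part_runs\<close>: each 1 is a lollipop with pivot \<open>U k\<close> or
  \<open>V k\<close>, each other summand a run inside the next smaller right part.\<close>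

fun stepsX stepsT stepsS stepsW stepsY :: "nat \<Rightarrow> nat" where
  "stepsX 0 = 3"
| "stepsT 0 = 3"
| "stepsS 0 = 3"
| "stepsW 0 = 1"
| "stepsY 0 = 1"
| "stepsX (Suc m) = 1 + (stepsW m + (1 + stepsT m))"
| "stepsT (Suc m) = stepsS m + (1 + (stepsW m + 1))"
| "stepsS (Suc m) = 1 + (stepsX m + 1)"
| "stepsW (Suc m) = stepsY m + 1"
| "stepsY (Suc m) = stepsX m"

text \<open>
  The graph outside \<open>R\<^sub>k\<close> is seen only through the arbitrary lists \<open>A\<close> and \<open>B\<close> (or \<open>L\<close> in
  \<open>inner_run\<close>). For \<open>R\<^sub>k\<^sub>+\<^sub>1\<close> they absorb \<open>U k\<close> and \<open>V k\<close>, which makes induction on the number of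
  gadgets possible.
\<close>

definition detour ::
  "'a set set \<Rightarrow> 'a list \<Rightarrow> 'a list \<Rightarrow> 'a \<Rightarrow> 'a \<Rightarrow> nat \<Rightarrow> 'a \<Rightarrow> 'a \<Rightarrow> bool" where
  "detour E R R' b b' l z f \<longleftrightarrow>
     (\<forall>A B. A \<noteq> [] \<longrightarrow> B \<noteq> [] \<longrightarrow> hd B = b \<longrightarrow> last B = b' \<longrightarrow>
            pivot_run E (A @ R @ B) z l (A @ R' @ rev B) f)"

lemma detourI:
  "(\<And>A B. A \<noteq> [] \<Longrightarrow> B \<noteq> [] \<Longrightarrow> hd B = b \<Longrightarrow> last B = b' \<Longrightarrow>
     pivot_run E (A @ R @ B) z l (A @ R' @ rev B) f) \<Longrightarrow> detour E R R' b b' l z f"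
  unfolding detour_def by blast

lemma detourD:
  "detour E R R' b b' l z f \<Longrightarrow> A \<noteq> [] \<Longrightarrow> B \<noteq> [] \<Longrightarrow> hd B = b \<Longrightarrow> last B = b' \<Longrightarrow>
    P = A @ R @ B \<Longrightarrow> Q = A @ R' @ rev B \<Longrightarrow> pivot_run E P z l Q f"
  unfolding detour_def by blast

lemma detour_sym:
  assumes "detour E R R' b b' l z f"
  shows "detour E R' R b' b l f z"
proof (rule detourI)
  fix A B :: "'a list"
  assume "A \<noteq> []" "B \<noteq> []" "hd B = b'" "last B = b"
  then have "pivot_run E (A @ R @ rev B) z l (A @ R' @ B) f"
    by (intro detourD[OF assms, of A "rev B"]) (auto simp: hd_rev last_rev)
  then show "pivot_run E (A @ R' @ B) f l (A @ R @ rev B) z"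
    by (rule pivot_run_sym)
qed

fun level :: "vertex \<Rightarrow> int" where
  "level (U i) = i"
| "level (V i) = i"

text \<open>The extreme pivots of these runs depend on the number of gadgets left, so they are only
  bounded by level. This suffices to tell them from the pivots \<open>U (k - 1)\<close> and
  \<open>V (k - 1)\<close> used one level further out.\<close>

definition inner_run ::
  "vertex set set \<Rightarrow> int \<Rightarrow> vertex list \<Rightarrow> vertex list \<Rightarrow> nat \<Rightarrow> bool" where
  "inner_run E k R R' l \<longleftrightarrow>
     (\<exists>z f. k \<le> level z \<and> k \<le> level f \<and> (\<forall>L. L \<noteq> [] \<longrightarrow> pivot_run E (L @ R) z l (L @ R') f))"

lemma pivot_run_single:
  "A \<noteq> [] \<Longrightarrow> 2 \<le> length B \<Longrightarrow> {z, hd B} \<in> E \<Longrightarrow> {z, last B} \<in> E \<Longrightarrow> P = A @ z # B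
    \<Longrightarrow> Q = A @ z # rev B \<Longrightarrow> pivot_run E P z 1 Q z"
  by (rule pivot_run.single) (rule pivot_stepI)

section \<open>Lollipops in the pac and, by induction, in every right part\<close>

lemma pac_runs:
  assumes k: "k = int n + 1"
  defines "E \<equiv> G_edges n"
  shows "detour E [U k, V k, U (k + 1)] [U k, U (k + 1), V k] (V (k - 1)) (U (k - 1)) 3 (V k) (U (k + 1))"
    and "detour E [V k, U (k + 1), U k] [V k, U k, U (k + 1)] (V (k - 2)) (V (k - 1)) 3 (U (k + 1)) (U k)"
    and "detour E [U (k + 1), U k, V k] [U (k + 1), V k, U k] (U (k - 1)) (V (k - 2)) 3 (U k) (V k)"
    and "inner_run E k [U k, V k, U (k + 1)] [U k, U (k + 1), V k] 1"
    and "inner_run E k [U (k + 1), V k, U k] [U (k + 1), U k, V k] 1"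
proof -
  \<comment> \<open>The pac is a triangle, so the three detours are one argument with the corners
    rotated. The pivots are \<open>q\<close>, \<open>p\<close>, \<open>r\<close> in this
    order.\<close>
  have cyclic: "detour E [p, q, r] [p, r, q] b b' 3 q r"
    if edges: "{p, q} \<in> E" "{q, r} \<in> E" "{p, r} \<in> E" "{r, b} \<in> E" "{q, b'} \<in> E"
      and ne: "p \<noteq> q" "q \<noteq> r" "p \<noteq> r" for p q r b b'
  proof (rule detourI)
    fix A B :: "vertex list"
    assume AB: "A \<noteq> []" "B \<noteq> []" "hd B = b" "last B = b'"
    have 1: "pivot_run E (A @ p # q # r # B) q 1 (A @ p # q # rev B @ [r]) q"
      using AB edges by (intro pivot_run_single[of "A @ [p]" "r # B"]) (auto simp: Suc_le_eq)
    have 2: "pivot_run E (A @ p # q # rev B @ [r]) p 1 (A @ p # r # B @ [q]) p"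
      using AB edges by (intro pivot_run_single[of A "q # rev B @ [r]"]) (auto simp: Suc_le_eq)
    have 3: "pivot_run E (A @ p # r # B @ [q]) r 1 (A @ p # r # q # rev B) r"
      using AB edges
      by (intro pivot_run_single[of "A @ [p]" "B @ [q]"]) (auto simp: Suc_le_eq insert_commute)
    have "pivot_run E (A @ p # q # r # B) q (1 + (1 + 1)) (A @ p # r # q # rev B) r"
      by (rule pivot_run_trans[OF 1 _ pivot_run_trans[OF 2 _ 3]]) (use ne in auto)
    then show "pivot_run E (A @ [p, q, r] @ B) q 3 (A @ [p, r, q] @ rev B) r"
      by (simp add: numeral_3_eq_3)
  qed
  show "detour E [U k, V k, U (k + 1)] [U k, U (k + 1), V k] (V (k - 1)) (U (k - 1)) 3 (V k) (U (k + 1))"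
    and "detour E [V k, U (k + 1), U k] [V k, U k, U (k + 1)] (V (k - 2)) (V (k - 1)) 3 (U (k + 1)) (U k)"
    and "detour E [U (k + 1), U k, V k] [U (k + 1), V k, U k] (U (k - 1)) (V (k - 2)) 3 (U k) (V k)"
    unfolding k by (rule cyclic; simp add: E_def edge_iff)+
  have "pivot_run E (L @ [U k, V k, U (k + 1)]) (U k) 1 (L @ [U k, U (k + 1), V k]) (U k)"
    if "L \<noteq> []" for L
    using that by (intro pivot_run_single[of L]) (auto simp: E_def k edge_iff)
  then show "inner_run E k [U k, V k, U (k + 1)] [U k, U (k + 1), V k] 1"
    unfolding inner_run_def by (intro exI[of _ "U k"]) auto
  have "pivot_run E (L @ [U (k + 1), V k, U k]) (U (k + 1)) 1 (L @ [U (k + 1), U k, V k]) (U (k + 1))"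
    if "L \<noteq> []" for L
    using that by (intro pivot_run_single[of L]) (auto simp: E_def k edge_iff)
  then show "inner_run E k [U (k + 1), V k, U k] [U (k + 1), U k, V k] 1"
    unfolding inner_run_def by (intro exI[of _ "U (k + 1)"]) auto
qed

text \<open>Single lollipops at level \<open>k\<close> alternate with runs whose extreme pivots have
  level at least \<open>k + 1\<close>. Hence the two pivots at each junction differ and no step is
  undone.\<close>

lemma right_part_runs:
  assumes "k + int m = int n + 1" "1 \<le> k"
  shows "detour (G_edges n) (pathS k m) (pathX k m) (V (k - 1)) (U (k - 1)) (stepsX m) (V k) (U (k + 1))"
    and "detour (G_edges n) (rev (pathW k m)) (pathT k m) (V (k - 2)) (V (k - 1)) (stepsT m) (U (k + 1)) (U k)"
    and "detour (G_edges n) (pathY k m) (rev (pathS k m)) (U (k - 1)) (V (k - 2)) (stepsS m) (U k) (V k)"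
    and "inner_run (G_edges n) k (pathS k m) (pathW k m) (stepsW m)"
    and "inner_run (G_edges n) k (rev (pathS k m)) (pathY k m) (stepsY m)"
  using assms
proof (induction m arbitrary: k)
  case 0
  note base = of_nat_0 add_0_right pathS.simps(1) pathX.simps(1) pathT.simps(1) pathW.simps(1)
    pathY.simps(1) stepsX.simps(1) stepsT.simps(1) stepsS.simps(1) stepsW.simps(1) stepsY.simps(1)
    rev.simps append.simps simp_thms
  {
    case 1 then show ?case using pac_runs(1)[of k n] by (simp only: base)
  next
    case 2 then show ?case using pac_runs(2)[of k n] by (simp only: base)
  next
    case 3 then show ?case using pac_runs(3)[of k n] by (simp only: base)
  next
    case 4 then show ?case using pac_runs(4)[of k n] by (simp only: base)
  next
    case 5 then show ?case using pac_runs(5)[of k n] by (simp only: base)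
  }
next
  case (Suc m)
  define E where "E = G_edges n"
  define S where "S k = pathS (k + 1) m" for k
  define X where "X k = pathX (k + 1) m" for k
  define T where "T k = pathT (k + 1) m" for k
  define W where "W k = pathW (k + 1) m" for k
  define Y where "Y k = pathY (k + 1) m" for k
  note paths = S_def X_def T_def W_def Y_def
  have detourX: "detour E (S k) (X k) (V k) (U k) (stepsX m) (V (k + 1)) (U (k + 2))"
    and detourT: "detour E (rev (W k)) (T k) (V (k - 1)) (V k) (stepsT m) (U (k + 2)) (U (k + 1))"
    and detourS: "detour E (Y k) (rev (S k)) (U k) (V (k - 1)) (stepsS m) (U (k + 1)) (V (k + 1))"
    and innerW: "inner_run E (k + 1) (S k) (W k) (stepsW m)"
    and innerY: "inner_run E (k + 1) (rev (S k)) (Y k) (stepsY m)"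
    if "k + int (Suc m) = int n + 1" "1 \<le> k" for k
  proof -
    have k: "k + 1 + int m = int n + 1" "1 \<le> k + 1" using that by simp_all
    have eq: "k + 1 + 1 = k + 2" "k + 1 - 1 = k" "k + 1 - 2 = k - 1" by simp_all
    note IH = Suc.IH[OF k, unfolded eq]
    show "detour E (S k) (X k) (V k) (U k) (stepsX m) (V (k + 1)) (U (k + 2))"
      unfolding paths E_def by (fact IH)
    show "detour E (rev (W k)) (T k) (V (k - 1)) (V k) (stepsT m) (U (k + 2)) (U (k + 1))"
      unfolding paths E_def by (fact IH)
    show "detour E (Y k) (rev (S k)) (U k) (V (k - 1)) (stepsS m) (U (k + 1)) (V (k + 1))"
      unfolding paths E_def by (fact IH)
    show "inner_run E (k + 1) (S k) (W k) (stepsW m)"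
      unfolding paths E_def by (fact IH)
    show "inner_run E (k + 1) (rev (S k)) (Y k) (stepsY m)"
      unfolding paths E_def by (fact IH)
  qed
  {
    case 1
    show ?case
    proof (rule detourI)
      fix A B :: "vertex list"
      assume AB: "A \<noteq> []" "B \<noteq> []" "hd B = V (k - 1)" "last B = U (k - 1)"
      \<comment> \<open>The end \<open>U (k - 1)\<close> of \<open>B\<close> sees
        \<open>V k\<close>. This puts the end of the path into the smaller right part, where W
        brings it to \<open>V (k + 1)\<close>, a neighbour of \<open>U k\<close>; after that pivot
        the smaller part is entered through its own \<alpha>, ready for T.\<close>
      have r1: "pivot_run E (A @ U k # V k # rev (S k) @ B) (V k) 1
          (A @ U k # V k # rev B @ S k) (V k)"
        using AB 1 by (intro pivot_run_single[of "A @ [U k]" "rev (S k) @ B"])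
          (auto simp: paths E_def edge_iff hd_rev Suc_le_eq)
      obtain z f where zf: "k + 1 \<le> level z" "k + 1 \<le> level f"
        and run: "\<And>L. L \<noteq> [] \<Longrightarrow> pivot_run E (L @ S k) z (stepsW m) (L @ W k) f"
        using innerW[OF 1] unfolding inner_run_def by blast
      have r2: "pivot_run E (A @ U k # V k # rev B @ S k) z (stepsW m)
          (A @ U k # V k # rev B @ W k) f"
        using run[of "A @ U k # V k # rev B"] by simp
      have r3: "pivot_run E (A @ U k # V k # rev B @ W k) (U k) 1
          (A @ U k # rev (W k) @ B @ [V k]) (U k)"
        using AB 1 by (intro pivot_run_single[of A "V k # rev B @ W k"])
          (auto simp: paths E_def edge_iff Suc_le_eq)
      have r4: "pivot_run E (A @ U k # rev (W k) @ B @ [V k]) (U (k + 2)) (stepsT m)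
          (A @ U k # T k @ V k # rev B) (U (k + 1))"
        using AB by (intro detourD[OF detourT[OF 1], of "A @ [U k]" "B @ [V k]"]) auto
      have "pivot_run E (A @ U k # V k # rev (S k) @ B) (V k) (1 + (stepsW m + (1 + stepsT m)))
          (A @ U k # T k @ V k # rev B) (U (k + 1))"
        by (rule pivot_run_trans[OF r1 _ pivot_run_trans[OF r2 _ pivot_run_trans[OF r3 _ r4]]])
          (use zf(1,2) in auto)
      then show "pivot_run (G_edges n) (A @ pathS k (Suc m) @ B) (V k) (stepsX (Suc m))
          (A @ pathX k (Suc m) @ rev B) (U (k + 1))"
        by (simp add: paths E_def)
    qed
  next
    case 2
    show ?case
    proof (rule detourI)
      fix A B :: "vertex list"
      assume AB: "A \<noteq> []" "B \<noteq> []" "hd B = V (k - 2)" "last B = V (k - 1)"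
      \<comment> \<open>The end \<open>V (k - 1)\<close> of \<open>B\<close> sees
        \<open>U (k + 1)\<close> in the smaller right part, so that part moves first, with
        \<open>U k # B\<close> as its outside.\<close>
      have r1: "pivot_run E (A @ V k # Y k @ U k # B) (U (k + 1)) (stepsS m)
          (A @ V k # rev (S k) @ rev B @ [U k]) (V (k + 1))"
        using AB by (intro detourD[OF detourS[OF 2], of "A @ [V k]" "U k # B"]) auto
      have r2: "pivot_run E (A @ V k # rev (S k) @ rev B @ [U k]) (V k) 1
          (A @ V k # U k # B @ S k) (V k)"
        using AB 2 by (intro pivot_run_single[of A "rev (S k) @ rev B @ [U k]"])
          (auto simp: paths E_def edge_iff hd_rev Suc_le_eq)
      obtain z f where zf: "k + 1 \<le> level z" "k + 1 \<le> level f"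
        and run: "\<And>L. L \<noteq> [] \<Longrightarrow> pivot_run E (L @ S k) z (stepsW m) (L @ W k) f"
        using innerW[OF 2] unfolding inner_run_def by blast
      have r3: "pivot_run E (A @ V k # U k # B @ S k) z (stepsW m)
          (A @ V k # U k # B @ W k) f"
        using run[of "A @ V k # U k # B"] by simp
      have r4: "pivot_run E (A @ V k # U k # B @ W k) (U k) 1
          (A @ V k # U k # rev (W k) @ rev B) (U k)"
        using AB 2 by (intro pivot_run_single[of "A @ [V k]" "B @ W k"])
          (auto simp: paths E_def edge_iff Suc_le_eq)
      have "pivot_run E (A @ V k # Y k @ U k # B) (U (k + 1)) (stepsS m + (1 + (stepsW m + 1)))
          (A @ V k # U k # rev (W k) @ rev B) (U k)"
        by (rule pivot_run_trans[OF r1 _ pivot_run_trans[OF r2 _ pivot_run_trans[OF r3 _ r4]]])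
          (use zf(1,2) in auto)
      then show "pivot_run (G_edges n) (A @ rev (pathW k (Suc m)) @ B) (U (k + 1)) (stepsT (Suc m))
          (A @ pathT k (Suc m) @ rev B) (U k)"
        by (simp add: paths E_def)
    qed
  next
    case 3
    show ?case
    proof (rule detourI)
      fix A B :: "vertex list"
      assume AB: "A \<noteq> []" "B \<noteq> []" "hd B = U (k - 1)" "last B = V (k - 2)"
      have r1: "pivot_run E (A @ X k @ U k # V k # B) (U k) 1 (A @ X k @ U k # rev B @ [V k]) (U k)"
        using AB 3 by (intro pivot_run_single[of "A @ X k" "V k # B"])
          (auto simp: paths E_def edge_iff Suc_le_eq)
      \<comment> \<open>The smaller right part is entered through its \<beta> and its exit moves
        back from \<alpha> to \<gamma>, which is X run in reverse.\<close>
      have r2: "pivot_run E (A @ X k @ U k # rev B @ [V k]) (U (k + 2)) (stepsX m)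
          (A @ S k @ V k # B @ [U k]) (V (k + 1))"
        using AB by (intro detourD[OF detour_sym[OF detourX[OF 3]], of A "U k # rev B @ [V k]"]) auto
      have r3: "pivot_run E (A @ S k @ V k # B @ [U k]) (V k) 1
          (A @ S k @ V k # U k # rev B) (V k)"
        using AB 3 by (intro pivot_run_single[of "A @ S k" "B @ [U k]"])
          (auto simp: paths E_def edge_iff Suc_le_eq)
      have "pivot_run E (A @ X k @ U k # V k # B) (U k) (1 + (stepsX m + 1))
          (A @ S k @ V k # U k # rev B) (V k)"
        by (rule pivot_run_trans[OF r1 _ pivot_run_trans[OF r2 _ r3]]) auto
      then show "pivot_run (G_edges n) (A @ pathY k (Suc m) @ B) (U k) (stepsS (Suc m))
          (A @ rev (pathS k (Suc m)) @ rev B) (V k)"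
        by (simp add: paths E_def)
    qed
  next
    case 4
    obtain z f where zf: "k + 1 \<le> level z" "k + 1 \<le> level f"
      and run: "\<And>L. L \<noteq> [] \<Longrightarrow> pivot_run E (L @ rev (S k)) z (stepsY m) (L @ Y k) f"
      using innerY[OF 4] unfolding inner_run_def by blast
    have "pivot_run E (L @ U k # V k # rev (S k)) z (stepsY m + 1)
        (L @ U k # rev (Y k) @ [V k]) (U k)" if "L \<noteq> []" for L
    proof (rule pivot_run_trans)
      show "pivot_run E (L @ U k # V k # rev (S k)) z (stepsY m) (L @ U k # V k # Y k) f"
        using run[of "L @ [U k, V k]"] by simp
      show "pivot_run E (L @ U k # V k # Y k) (U k) 1 (L @ U k # rev (Y k) @ [V k]) (U k)"
        using that 4 by (intro pivot_run_single[of L "V k # Y k"])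
          (auto simp: paths E_def edge_iff Suc_le_eq)
    qed (use zf in auto)
    then show ?case
      unfolding inner_run_def using zf
      by (intro exI[of _ z] exI[of _ "U k"]) (auto simp: paths E_def)
  next
    case 5
    \<comment> \<open>The vertices of this gadget serve as the outside behind the smaller right
      part, so a detour there becomes an inner run here.\<close>
    have "pivot_run E (L @ S k @ [V k, U k]) (V (k + 1)) (stepsX m) (L @ X k @ [U k, V k]) (U (k + 2))"
      if "L \<noteq> []" for L
      using that by (intro detourD[OF detourX[OF 5], of L "[V k, U k]"]) auto
    then show ?case
      unfolding inner_run_def
      by (intro exI[of _ "V (k + 1)"] exI[of _ "U (k + 2)"]) (auto simp: paths E_def)
  }
qed

section \<open>The initial and the final cycle\<close>

lemma path_edges_pathS:
  "path_edges (pathS k m) =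
    (\<lambda>i. {U i, V i}) ` {k..k + int m} \<union> (\<lambda>i. {V i, U (i + 2)}) ` {k..<k + int m} \<union>
    {{V (k + int m), U (k + int m + 1)}}"
proof (induction m arbitrary: k)
  case 0
  then show ?case by (simp add: insert_commute)
next
  case (Suc m)
  have ivl: "{k..k + int (Suc m)} = insert k {k + 1..k + 1 + int m}"
    "{k..<k + int (Suc m)} = insert k {k + 1..<k + 1 + int m}" by auto
  have end_eq: "k + int (Suc m) = k + 1 + int m" by simp
  have step: "path_edges (pathS k (Suc m)) =
      insert {U k, V k} (insert {V k, U (k + 2)} (path_edges (pathS (k + 1) m)))"
    by (simp add: path_edges_Cons hd_rev add.commute)
  show ?case
    unfolding step Suc.IH ivl image_insert unfolding end_eq by blast
qed

lemma set_pathS: "set (pathS k m) = U ` {k..k + int m + 1} \<union> V ` {k..k + int m}"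
proof (induction m arbitrary: k)
  case 0
  have "{k..k + 1} = {k, k + 1}" by auto
  then show ?case by auto
next
  case (Suc m)
  have "{k..k + int (Suc m) + 1} = insert k {k + 1..k + 1 + int m + 1}"
    "{k..k + int (Suc m)} = insert k {k + 1..k + 1 + int m}" by auto
  then show ?case by (simp only: pathS.simps list.set set_rev Suc.IH image_insert) blast
qed

lemma distinct_pathS: "distinct (pathS k m)"
  by (induction m arbitrary: k) (auto simp: set_pathS)

text \<open>The Boolean is the parity of the gadgets whose inner edge is used: \<open>True\<close>
  stands for even indices, as in \<open>C1\<close>.\<close>

fun zigzag :: "bool \<Rightarrow> int \<Rightarrow> nat \<Rightarrow> vertex set set" where
  "zigzag b k 0 =
    insert {U k, U (k + 1)} (if even k = b then {{U k, V k}} else {{V k, U (k + 1)}})"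
| "zigzag b k (Suc m) =
    insert {U k, V (k + 1)} (insert (if even k = b then {U k, V k} else {V k, U (k + 2)})
      (zigzag b (k + 1) m))"

text \<open>One level down, X turns into T, T into W, W into Y and Y into X. So paths avoiding the
  edge of the first gadget (X, W) alternate with paths using it (T, Y), which is the parity pattern
  of \<open>C1\<close>.\<close>

lemma path_edges_eq_zigzag:
  "path_edges (pathX k m) = zigzag (odd k) k m"
  "path_edges (pathT k m) = zigzag (even k) k m"
  "path_edges (pathW k m) = zigzag (odd k) k m"
  "path_edges (pathY k m) = zigzag (even k) k m"
proof (induction m arbitrary: k)
  case (Suc m)
  {
    case 1 show ?case
      by (simp add: path_edges_Cons path_edges_append Suc.IH insert_commute add.commute)
  next
    case 2 show ?case
      by (simp add: path_edges_Cons Suc.IH hd_rev insert_commute)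
  next
    case 3 show ?case
      by (simp add: path_edges_Cons path_edges_append Suc.IH hd_rev last_rev insert_commute add.commute)
  next
    case 4 show ?case
      by (simp add: path_edges_append Suc.IH insert_commute)
  }
qed (simp_all add: insert_commute)

lemma zigzag_eq:
  "zigzag b k m =
    (\<lambda>i. {U i, V i}) ` {i. even i = b \<and> k \<le> i \<and> i < k + int m} \<union>
    (\<lambda>i. {U i, V (i + 1)}) ` {k..<k + int m} \<union>
    (\<lambda>i. {V i, U (i + 2)}) ` {i. even i \<noteq> b \<and> k \<le> i \<and> i < k + int m} \<union>
    zigzag b (k + int m) 0"
proof (induction m arbitrary: k)
  case 0
  have "{i. even i = b \<and> k \<le> i \<and> i < k + int 0} = {}"
    "{i. even i \<noteq> b \<and> k \<le> i \<and> i < k + int 0} = {}" by auto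
  then show ?case
    by (simp only: image_empty Un_empty_left of_nat_0 add_0_right atLeastLessThan_empty order_refl)
next
  case (Suc m)
  have sets: "{k..<k + int (Suc m)} = insert k {k + 1..<k + 1 + int m}"
    "{i. even i = b' \<and> k \<le> i \<and> i < k + int (Suc m)} =
      (if even k = b' then insert k else id) {i. even i = b' \<and> k + 1 \<le> i \<and> i < k + 1 + int m}"
    for b' by (auto simp: order_le_less)
  \<comment> \<open>With this, the set for \<open>even i \<noteq> b\<close> is an instance of the
    preceding rule, at the negation of \<open>b\<close>.\<close>
  have "(even k \<noteq> b) = (even k = (\<not> b))" for k :: int by auto
  note sets = sets this
  have end_eq: "k + int (Suc m) = k + 1 + int m" by simp
  show ?case
    unfolding zigzag.simps(2) Suc.IH sets unfolding end_eq
    by (simp del: zigzag.simps)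
qed

definition start_path :: "nat \<Rightarrow> vertex list" where
  "start_path n = V (- 1) # pathS 1 n @ [V 0, U 0]"

definition end_path :: "nat \<Rightarrow> vertex list" where
  "end_path n = V (- 1) # pathX 1 n @ [U 0, V 0]"

lemma cycle_edges_start_path: "cycle_edges (start_path n) = C0 n"
proof -
  have sets: "{i. 1 \<le> i \<and> i \<le> int n} = {1..int n}" "{1..1 + int n} = insert (int n + 1) {1..int n}"
    "{i. - 1 \<le> i \<and> i \<le> int n} = insert (- 1) (insert 0 {1..<1 + int n})" by auto
  show ?thesis
    unfolding C0_def setcompr_eq_image sets start_path_def cycle_edges_eq
    by (simp add: path_edges_Cons path_edges_append path_edges_pathS sets insert_commute add.commute)
qed

lemma cycle_edges_end_path: "cycle_edges (end_path n) = C1 n"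
proof -
  have sets: "{i. even i \<and> 1 \<le> i \<and> i \<le> int n} = {i. even i = True \<and> 1 \<le> i \<and> i < 1 + int n}"
    "{i. 0 \<le> i \<and> i \<le> int n} = insert 0 {1..<1 + int n}" by auto
  \<comment> \<open>The value 0 is even, so beside the gadgets only \<open>i = - 1\<close> remains,
    which is the green edge.\<close>
  have "i = - 1 \<or> 1 \<le> i" if "odd i" "- 1 \<le> i" for i :: int
    using that by (cases "i = 0") auto
  then have sets': "{i. odd i \<and> - 1 \<le> i \<and> i \<le> int n} =
      insert (- 1) {i. even i \<noteq> True \<and> 1 \<le> i \<and> i < 1 + int n}" by auto
  have pac: "zigzag True (1 + int n) 0 =
    (if even n then {{V (int n + 1), U (int n + 2)}, {U (int n + 2), U (int n + 1)}}
     else {{V (int n + 1), U (int n + 1)}, {U (int n + 2), U (int n + 1)}})"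
    by (simp add: insert_commute add.commute)
  show ?thesis
    unfolding C1_def setcompr_eq_image sets sets' end_path_def cycle_edges_eq
    by (simp add: path_edges_Cons path_edges_append path_edges_eq_zigzag zigzag_eq[of True 1 n] pac
        insert_commute del: zigzag.simps)
qed

section \<open>Cubicity and the whole run\<close>

lemma G_verts_eq: "G_verts n = U ` {0..int n + 2} \<union> V ` {- 1..int n + 1}"
proof -
  have "{0..int n + 2} = {0} \<union> {i. 1 \<le> i \<and> i \<le> int n} \<union> {int n + 1, int n + 2}"
    "{- 1..int n + 1} = {- 1, 0} \<union> {i. 1 \<le> i \<and> i \<le> int n} \<union> {int n + 1}" by auto
  then show ?thesis
    unfolding G_verts_def setcompr_eq_image by (simp only: image_Un) auto
qed

lemma card_G_verts: "2 < card (G_verts n)"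
proof -
  have "card (U ` {0..int n + 2}) = n + 3"
    by (simp add: card_image inj_on_def)
  then show ?thesis
    using card_mono[of "G_verts n" "U ` {0..int n + 2}"] by (simp add: G_verts_eq)
qed

lemma card_incident_edges:
  assumes "\<And>e. e \<in> E \<Longrightarrow> \<exists>x y. x \<noteq> y \<and> e = {x, y}"
  shows "card {e \<in> E. v \<in> e} = card {w. {v, w} \<in> E}"
proof -
  have "{e \<in> E. v \<in> e} = (\<lambda>w. {v, w}) ` {w. {v, w} \<in> E}"
    using assms by (fastforce simp: insert_commute)
  moreover have "inj_on (\<lambda>w. {v, w}) {w. {v, w} \<in> E}"
    by (auto simp: inj_on_def doubleton_eq_iff)
  ultimately show ?thesis by (simp add: card_image)
qed

lemma G_edges_cases:
  assumes "e \<in> G_edges n"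
  obtains i j where "e = {U i, V j}" | i j where "e = {U i, U j}" | i j where "e = {V i, V j}"
  using assms unfolding G_edges_def Un_iff insert_iff empty_iff mem_Collect_eq
  by (elim disjE exE conjE; metis insert_commute)

lemma G_edges_doubleton:
  assumes "e \<in> G_edges n"
  shows "\<exists>x y. x \<in> G_verts n \<and> y \<in> G_verts n \<and> x \<noteq> y \<and> e = {x, y}"
  using assms
proof (cases rule: G_edges_cases)
  case (1 i j)
  then show ?thesis using assms
    by (intro exI[of _ "U i"] exI[of _ "V j"]) (auto simp: UV_edge_iff G_verts_eq)
next
  case (2 i j)
  then show ?thesis using assms
    by (intro exI[of _ "U i"] exI[of _ "U j"]) (auto simp: UU_edge_iff G_verts_eq)
next
  case (3 i j)
  then show ?thesis using assms
    by (intro exI[of _ "V i"] exI[of _ "V j"]) (auto simp: VV_edge_iff G_verts_eq)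
qed

lemma G_neighbours_U:
  assumes "0 \<le> i" "i \<le> int n + 2"
  shows "{w. {U i, w} \<in> G_edges n} =
    (if i = int n + 2 then {V (i - 2), V (i - 1), U (i - 1)}
     else if i = 0 then {V 0, V 1, V (- 1)}
     else if i = int n + 1 then {V i, V (i - 2), U (i + 1)}
     else {V i, V (i + 1), V (i - 2)})"
proof (rule set_eqI)
  fix w
  show "w \<in> {w. {U i, w} \<in> G_edges n} \<longleftrightarrow> w \<in>
    (if i = int n + 2 then {V (i - 2), V (i - 1), U (i - 1)}
     else if i = 0 then {V 0, V 1, V (- 1)}
     else if i = int n + 1 then {V i, V (i - 2), U (i + 1)}
     else {V i, V (i + 1), V (i - 2)})"
    using assms by (cases w) (simp_all add: edge_iff; linarith)+
qed

lemma G_neighbours_V: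
  assumes "- 1 \<le> j" "j \<le> int n + 1"
  shows "{w. {V j, w} \<in> G_edges n} =
    (if j = - 1 then {U 1, U 0, V 0}
     else if j = 0 then {U 0, U 2, V (- 1)}
     else {U j, U (j - 1), U (if j = int n + 1 then j + 1 else j + 2)})"
proof (rule set_eqI)
  fix w
  show "w \<in> {w. {V j, w} \<in> G_edges n} \<longleftrightarrow> w \<in>
    (if j = - 1 then {U 1, U 0, V 0}
     else if j = 0 then {U 0, U 2, V (- 1)}
     else {U j, U (j - 1), U (if j = int n + 1 then j + 1 else j + 2)})"
    using assms by (cases w) (simp_all add: edge_iff; linarith)+
qed

lemma cubic_graph_G: "cubic_graph (G_verts n) (G_edges n)"
proof -
  have "card {w. {v, w} \<in> G_edges n} = 3" if "v \<in> G_verts n" for v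
  proof (cases v)
    case (U i)
    then have "0 \<le> i" "i \<le> int n + 2" using that by (auto simp: G_verts_eq)
    then show ?thesis unfolding U by (subst G_neighbours_U) auto
  next
    case (V j)
    then have "- 1 \<le> j" "j \<le> int n + 1" using that by (auto simp: G_verts_eq)
    then show ?thesis unfolding V by (subst G_neighbours_V) auto
  qed
  moreover have "card {e \<in> G_edges n. v \<in> e} = card {w. {v, w} \<in> G_edges n}" for v
    using G_edges_doubleton by (intro card_incident_edges) blast
  moreover have "finite (G_verts n)" by (simp add: G_verts_eq)
  ultimately show ?thesis
    unfolding cubic_graph_def using G_edges_doubleton by simp
qed

lemma C0_subset: "C0 n \<subseteq> G_edges n"
proof -
  \<comment> \<open>Every piece of \<open>C0\<close> occurs verbatim in \<open>G_edges\<close>, so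
    the inclusion holds with the pieces as variables.\<close>
  have "A \<union> B \<union> {a, b, c, d} \<subseteq> {a, x, b} \<union> {c, d, y} \<union> A \<union> Z \<union> B"
    for A B Z :: "vertex set set" and a b c d x y
    by blast
  then show ?thesis unfolding C0_def G_edges_def .
qed

lemma ham_path_start_path: "ham_path (G_verts n) (G_edges n) (start_path n)"
proof -
  have "path_edges (start_path n) \<subseteq> G_edges n"
    using C0_subset[of n] cycle_edges_start_path[of n] by (auto simp: cycle_edges_eq)
  moreover have "{0..int n + 2} = insert 0 {1..1 + int n + 1}"
    "{- 1..int n + 1} = insert (- 1) (insert 0 {1..1 + int n})" by auto
  then have "set (start_path n) = G_verts n"
    by (simp only: G_verts_eq start_path_def set_append list.set set_pathS image_insert) blast
  moreover have "distinct (start_path n)"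
    by (auto simp: start_path_def distinct_pathS set_pathS)
  ultimately show ?thesis by (simp add: ham_path_iff)
qed

theorem thomason_halts_G_iff:
  "thomason_halts (G_verts n) (G_edges n) (C0 n) green_edge cap_L k D \<longleftrightarrow>
    k = stepsX n \<and> D = C1 n"
proof -
  \<comment> \<open>For \<open>k = 1\<close> the joining edge \<beta> is the green edge, and
    \<alpha> and \<gamma> lead to x and y. The outside is \<Lambda> in front and y, x
    behind.\<close>
  have "detour (G_edges n) (pathS 1 n) (pathX 1 n) (V 0) (U 0) (stepsX n) (V 1) (U 2)"
    using right_part_runs(1)[of 1 n n] by simp
  then have "pivot_run (G_edges n) (start_path n) (V 1) (stepsX n) (end_path n) (U 2)"
    by (rule detourD[where A = "[V (- 1)]" and B = "[V 0, U 0]"])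
      (simp_all add: start_path_def end_path_def)
  then have "thomason_halts (G_verts n) (G_edges n) (cycle_edges (start_path n))
      {start_path n ! 0, start_path n ! 1} (hd (start_path n)) k D \<longleftrightarrow>
      k = stepsX n \<and> D = cycle_edges (end_path n)"
    by (intro thomason_halts_iff_pivot_run cubic_graph_G ham_path_start_path card_G_verts)
      (simp_all add: start_path_def end_path_def edge_iff)
  moreover have "start_path n ! 1 = U 1"
    using hd_conv_nth[of "pathS 1 n"] by (simp add: start_path_def nth_append)
  moreover have "start_path n ! 0 = V (- 1)" "hd (start_path n) = V (- 1)"
    by (simp_all add: start_path_def)
  ultimately show ?thesis
    by (simp add: cycle_edges_start_path cycle_edges_end_path green_edge_def)
qed

section \<open>The growth rate\<close>

text \<open>\<open>stepsX (n + 1)\<close> enters through \<open>stepsW (n + 3)\<close> and through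
  \<open>stepsS (n + 2)\<close>, and \<open>stepsX n\<close> through
  \<open>stepsW (n + 2)\<close>.\<close>

lemma stepsX_rec: "stepsX (n + 4) = 2 * stepsX (n + 1) + stepsX n + 8"
  by (simp add: numeral_eq_Suc)

lemma stepsX_init: "stepsX 0 = 3" "stepsX 1 = 6" "stepsX 2 = 10" "stepsX 3 = 15"
  by (simp_all add: numeral_eq_Suc)

lemma four_step_induct [case_names 0 1 2 3 step]:
  fixes P :: "nat \<Rightarrow> bool"
  assumes "P 0" "P 1" "P 2" "P 3" "\<And>n. P n \<Longrightarrow> P (n + 1) \<Longrightarrow> P (n + 4)"
  shows "P n"
proof (induction n rule: less_induct)
  case (less n)
  show ?case
  proof (cases "n < 4")
    case True
    then have "n = 0 \<or> n = 1 \<or> n = 2 \<or> n = 3" by auto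
    then show ?thesis using assms(1-4) by auto
  next
    case False
    then show ?thesis using assms(5)[of "n - 4"] less[of "n - 4"] less[of "n - 4 + 1"] by simp
  qed
qed

context
  fixes c :: real
  assumes c: "c ^ 4 = 2 * c + 1" "1 \<le> c" "c \<le> 2"
begin

lemma power_rec: "c ^ (n + 4) = 2 * c ^ (n + 1) + c ^ n"
  by (simp only: power_add c(1)) (simp add: algebra_simps)

lemma stepsX_lower: "c ^ n \<le> real (stepsX n)"
proof (induction n rule: four_step_induct)
  case 2
  show ?case using power_mono[OF c(3), of 2] c(2) by (simp add: stepsX_init)
next
  case 3
  show ?case using power_mono[OF c(3), of 3] c(2) by (simp add: stepsX_init)
next
  case (step n)
  then show ?case unfolding power_rec stepsX_rec by simp
qed (use c in \<open>simp_all add: stepsX_init\<close>)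

text \<open>Adding 4 absorbs the constant 8: \<open>stepsX n + 4\<close> satisfies the homogeneous
  recurrence, as does \<open>c ^ n\<close>. The factor 19 is its largest initial value,
  \<open>stepsX 3 + 4\<close>.\<close>

lemma stepsX_upper: "real (stepsX n) + 4 \<le> 19 * c ^ n"
proof (induction n rule: four_step_induct)
  case 1
  show ?case using c(2) by (simp add: stepsX_init)
next
  case 2
  show ?case using one_le_power[OF c(2), of 2] by (simp add: stepsX_init)
next
  case 3
  show ?case using one_le_power[OF c(2), of 3] by (simp add: stepsX_init)
next
  case (step n)
  then show ?case unfolding power_rec stepsX_rec by simp
qed (simp add: stepsX_init)

lemma stepsX_bigtheta: "(\<lambda>n. real (stepsX n)) \<in> \<Theta>(\<lambda>n. c ^ n)"
proof (rule bigthetaI)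
  have "real (stepsX n) \<le> 19 * c ^ n" for n
    using stepsX_upper[of n] by linarith
  then show "(\<lambda>n. real (stepsX n)) \<in> O(\<lambda>n. c ^ n)"
    using c(2) by (intro bigoI[of _ 19]) simp
  show "(\<lambda>n. real (stepsX n)) \<in> \<Omega>(\<lambda>n. c ^ n)"
    using c(2) stepsX_lower by (intro landau_omega.bigI[of 1]) simp_all
qed

end

lemma growth_rate_exists: "\<exists>c::real. 1.3953 \<le> c \<and> c < 1.3954 \<and> c ^ 4 = 2 * c + 1"
proof -
  have "\<exists>c\<ge>1.3953. c \<le> 1.3954 \<and> c ^ 4 - 2 * c = (1::real)"
    by (intro IVT') (auto intro!: continuous_intros simp: power4_eq_xxxx)
  then obtain c :: real where c: "1.3953 \<le> c" "c \<le> 1.3954" "c ^ 4 = 2 * c + 1"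
    by force
  \<comment> \<open>The intermediate value theorem gives a closed interval; its right end must be
    excluded for the fourth decimal to be 3.\<close>
  moreover have "(1.3954::real) ^ 4 \<noteq> 2 * 1.3954 + 1"
    by (simp add: power4_eq_xxxx)
  ultimately show ?thesis by (metis order_le_less)
qed

theorem theorem2:
  shows "\<exists>steps :: nat \<Rightarrow> nat.
    (\<forall>n\<ge>3. \<forall>k D. thomason_halts (G_verts n) (G_edges n) (C0 n) green_edge cap_L k D
                    \<longleftrightarrow> k = steps n \<and> D = C1 n) \<and>
    (\<exists>c::real. 1.3953 \<le> c \<and> c < 1.3954 \<and> (\<lambda>n. real (steps n)) \<in> \<Theta>(\<lambda>n. c ^ n))"
proof -
  obtain c :: real where "1.3953 \<le> c" "c < 1.3954" "c ^ 4 = 2 * c + 1"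
    using growth_rate_exists by blast
  moreover from this have "(\<lambda>n. real (stepsX n)) \<in> \<Theta>(\<lambda>n. c ^ n)"
    by (intro stepsX_bigtheta) simp_all
  ultimately show ?thesis
    using thomason_halts_G_iff by blast
qed

end
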